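(* Every $2$-saturated subcubic graph $G$ such that $g_3(G)=3$ is $(1,1,2)$-packing colorable.
   Context: All graphs are finite, simple and undirected. For a non-decreasing sequence $S=(s_1,\dots,s_k)$ of positive integers, an $S$-packing coloring of $G$ is a partition of $V(G)$ into sets $V_1,\dots,V_k$ such that any two distinct vertices $u,v\in V_i$ satisfy $dist_G(u,v)>s_i$; $G$ is $S$-packing colorable if it admits one. $G$ is subcubic if its maximum degree is at most $3$. A subcubic graph is $k$-saturated if every vertex of degree $3$ is adjacent to at most $k$ vertices of degree $3$. The local girth $g(v)$ of a vertex $v$ is the length of a shortest cycle containing $v$ ($\infty$ if none), and $g_3(G)=\max\{g(v): d_G(v)=3\}$. *)

theory Defs
  imports "Graph_Theory.Graph_Theory" "HOL-Library.Extended_Nat" "HOL-Library.Disjoint_Sets"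
begin

text \<open>
  Finite simple undirected graphs are the locale \<^locale>\<open>pair_graph\<close>: finite, loop-free,
  symmetric digraphs whose arcs are pairs of vertices. An undirected edge is the pair of arcs
  \<open>(u, v)\<close> and \<open>(v, u)\<close>, so out-degree is the usual degree.
\<close>

definition degree :: "'a pair_pre_digraph \<Rightarrow> 'a \<Rightarrow> nat" where
  "degree G v = out_degree (with_proj G) v"

definition subcubic :: "'a pair_pre_digraph \<Rightarrow> bool" where
  "subcubic G \<longleftrightarrow> (\<forall>v \<in> pverts G. degree G v \<le> 3)"

definition saturated :: "nat \<Rightarrow> 'a pair_pre_digraph \<Rightarrow> bool" where
  "saturated k G \<longleftrightarrow>
     (\<forall>v \<in> pverts G. degree G v = 3 \<longrightarrow>
        card {w \<in> pverts G. (v, w) \<in> parcs G \<and> degree G w = 3} \<le> k)"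

text \<open>The distance is \<open>\<infinity>\<close> between vertices of different components.\<close>

definition graph_dist :: "'a pair_pre_digraph \<Rightarrow> 'a \<Rightarrow> 'a \<Rightarrow> ereal" where
  "graph_dist G u v = wf_digraph.\<mu> (with_proj G) (\<lambda>_. 1) u v"

text \<open>
  In a symmetric digraph, going back and forth along one edge is a directed cycle of length 2;
  requiring length at least 3 leaves exactly the cycles of the undirected graph.
\<close>

definition undirected_cycle :: "'a pair_pre_digraph \<Rightarrow> ('a \<times> 'a) awalk \<Rightarrow> bool" where
  "undirected_cycle G p \<longleftrightarrow> pre_digraph.cycle (with_proj G) p \<and> 3 \<le> length p"

text \<open>The vertices of a cycle are the tails of its arcs, and \<open>Inf {} = \<infinity>\<close> in \<^typ>\<open>enat\<close>.\<close>

definition local_girth :: "'a pair_pre_digraph \<Rightarrow> 'a \<Rightarrow> enat" where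
  "local_girth G v = (INF p \<in> {p. undirected_cycle G p \<and> v \<in> fst ` set p}. enat (length p))"

text \<open>
  For a finite graph with a vertex of degree 3 this supremum is a maximum. Without such a
  vertex it is 0, which is not a possible local girth.
\<close>

definition g3 :: "'a pair_pre_digraph \<Rightarrow> enat" where
  "g3 G = (SUP v \<in> {v \<in> pverts G. degree G v = 3}. local_girth G v)"

text \<open>Colour classes may be empty; indices start at 0.\<close>

definition packing_coloring :: "nat list \<Rightarrow> 'a pair_pre_digraph \<Rightarrow> (nat \<Rightarrow> 'a set) \<Rightarrow> bool" where
  "packing_coloring S G V \<longleftrightarrow>
     (\<Union>i<length S. V i) = pverts G \<and>
     disjoint_family_on V {..<length S} \<and>
     (\<forall>i<length S. \<forall>u \<in> V i. \<forall>v \<in> V i. u \<noteq> v \<longrightarrow> graph_dist G u v > ereal (real (S ! i)))"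

definition packing_colorable :: "nat list \<Rightarrow> 'a pair_pre_digraph \<Rightarrow> bool" where
  "packing_colorable S G \<longleftrightarrow> (\<exists>V. packing_coloring S G V)"

end

theory Submission
  imports Defs
begin

text \<open>
  It suffices to find a set \<open>S\<close> of vertices at pairwise distance at least 3 whose complement induces
  a bipartite graph. If \<open>S\<close> meets every triangle, then every vertex has at most two neighbours
  outside \<open>S\<close>, since each vertex of degree 3 lies on a triangle.

  Such an \<open>S\<close> exists. A triangle with a vertex of degree 2, or sharing an edge with another
  triangle, contains a vertex all of whose edges lie in triangles, and that vertex can be picked.
  Any other triangle has three outer neighbours, all of degree at most 2 by saturation. Hall's
  theorem gives each of these triangles a private outer neighbour, and its neighbour in the
  triangle is picked.

  Now choose such an \<open>S\<close> and a 2-colouring \<open>f\<close> of its complement with as few monochromatic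
  edges as possible. Recolouring an end of a monochromatic edge moves that edge along; let \<open>P\<close> be
  the set of vertices that can meet a monochromatic edge in an optimal colouring for \<open>S\<close> (the union
  of the odd cycles outside \<open>S\<close>). If \<open>P\<close> contains a vertex of degree 2, then either such a
  vertex can be added to \<open>S\<close>, or a vertex of \<open>P\<close> can replace the vertex of \<open>S\<close> in its triangle,
  and both reduce the number of monochromatic edges. Otherwise the graph induced on \<open>P\<close> is a union
  of two perfect matchings, hence bipartite, and \<open>f\<close> can be improved on \<open>P\<close>.
\<close>

section \<open>Systems of distinct representatives and pairs of perfect matchings\<close>

text \<open>Rado's proof of Hall's theorem: shrink the sets while preserving Hall's condition.\<close>

lemma hall_sdr:
  fixes A :: "'i \<Rightarrow> 'b set"
  assumes "finite I" "\<And>i. i \<in> I \<Longrightarrow> finite (A i)"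
    and "\<And>J. J \<subseteq> I \<Longrightarrow> card J \<le> card (\<Union>(A ` J))"
  shows "\<exists>f. inj_on f I \<and> (\<forall>i\<in>I. f i \<in> A i)"
  using assms(2,3)
proof (induction "\<Sum>i\<in>I. card (A i)" arbitrary: A rule: less_induct)
  case less
  have ne: "A i \<noteq> {}" if "i \<in> I" for i
    using less.prems(2)[of "{i}"] that by auto
  show ?case
  proof (cases "\<exists>i\<in>I. \<exists>a\<in>A i. \<exists>b\<in>A i. a \<noteq> b")
    case False
    define f where "f i = (SOME a. a \<in> A i)" for i
    have f: "f i \<in> A i" if "i \<in> I" for i
      unfolding f_def using ne[OF that] by (simp add: some_in_eq)
    have A: "A i = {f i}" if "i \<in> I" for i
      using f[OF that] False that by auto
    have "inj_on f I"
    proof (rule inj_onI, rule ccontr)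
      fix i j assume ij: "i \<in> I" "j \<in> I" "f i = f j" "i \<noteq> j"
      then show False using less.prems(2)[of "{i,j}"] A[of i] A[of j] by simp
    qed
    then show ?thesis using f by blast
  next
    case True
    then obtain i a b where i: "i \<in> I" "a \<in> A i" "b \<in> A i" "a \<noteq> b" by blast
    define R where "R c = A(i := A i - {c})" for c
    have R_i: "R c i = A i - {c}" and R_j: "j \<noteq> i \<Longrightarrow> R c j = A j" for c j
      by (auto simp: R_def)
    have Rfin: "finite (R c j)" if "j \<in> I" for c j
      using less.prems(1)[OF that] by (auto simp: R_def)
    have R_sub: "R c j \<subseteq> A j" for c j by (auto simp: R_def)
    have small: "(\<Sum>j\<in>I. card (R c j)) < (\<Sum>j\<in>I. card (A j))" if "c \<in> A i" for c
    proof (rule sum_strict_mono_ex1)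
      show "\<forall>j\<in>I. card (R c j) \<le> card (A j)"
        using less.prems(1) R_sub by (simp add: card_mono)
      have "card (A i - {c}) < card (A i)"
        by (rule card_Diff1_less[OF less.prems(1)[OF i(1)] that])
      then show "\<exists>j\<in>I. card (R c j) < card (A j)" using i(1) R_i by metis
    qed (rule assms(1))
    \<comment> \<open>Suppose both deletions violate Hall's condition, at \<open>Ja\<close> and
      \<open>Jb\<close>. Then \<open>?X \<union> ?Y\<close> still covers the sets of
      \<open>Ja \<union> Jb\<close>, as \<open>a \<noteq> b\<close>, and
      \<open>?X \<inter> ?Y\<close> those of \<open>Ja \<inter> Jb - {i}\<close>. Adding
      cardinalities, the violations lose 2 but only 1 can be lost.\<close>
    have "\<exists>c\<in>{a,b}. \<forall>J\<subseteq>I. card J \<le> card (\<Union>(R c ` J))"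
    proof (rule ccontr)
      assume "\<not> ?thesis"
      then obtain Ja Jb where Ja: "Ja \<subseteq> I" "card (\<Union>(R a ` Ja)) < card Ja"
        and Jb: "Jb \<subseteq> I" "card (\<Union>(R b ` Jb)) < card Jb" 
        by (auto simp: not_le)
      have i_in: "i \<in> J" if "J \<subseteq> I" "card (\<Union>(R c ` J)) < card J" for J c
      proof (rule ccontr)
        assume "i \<notin> J"
        then have "R c ` J = A ` J" by (intro image_cong) (auto simp: R_def)
        then show False using less.prems(2)[OF that(1)] that(2) by simp
      qed
      have ia: "i \<in> Ja" and ib: "i \<in> Jb" using i_in Ja Jb by blast+
      let ?X = "\<Union>(R a ` Ja)" and ?Y = "\<Union>(R b ` Jb)"
      have finX: "finite ?X" and finY: "finite ?Y"
        using Ja(1) Jb(1) Rfin assms(1) by (auto intro!: finite_UN_I intro: finite_subset)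
      have finJ: "finite Ja" "finite Jb"
        using Ja(1) Jb(1) assms(1) finite_subset by blast+
      have "\<Union>(A ` (Ja \<union> Jb)) \<subseteq> ?X \<union> ?Y"
      proof
        fix x assume "x \<in> \<Union>(A ` (Ja \<union> Jb))"
        then obtain j where j: "j \<in> Ja \<union> Jb" "x \<in> A j" by blast
        show "x \<in> ?X \<union> ?Y"
        proof (cases "j = i")
          case True
          then have "x \<in> R a i \<or> x \<in> R b i" using j(2) i(4) R_i by auto
          then show ?thesis using ia ib by blast
        next
          case False
          then show ?thesis using j R_j by blast
        qed
      qed
      then have u: "card (Ja \<union> Jb) \<le> card (?X \<union> ?Y)"
        using less.prems(2)[of "Ja \<union> Jb"] Ja(1) Jb(1) card_mono[OF finite_UnI[OF finX finY]]
        by (meson Un_least le_trans)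
      have "\<Union>(A ` (Ja \<inter> Jb - {i})) \<subseteq> ?X \<inter> ?Y"
        by (fastforce simp: R_def)
      then have "card (Ja \<inter> Jb - {i}) \<le> card (?X \<inter> ?Y)"
        using less.prems(2)[of "Ja \<inter> Jb - {i}"] Ja(1) card_mono[OF finite_Int[OF disjI1[OF finX]]]
        by (meson Diff_subset Int_lower1 le_trans subset_trans)
      then have v: "card (Ja \<inter> Jb) \<le> Suc (card (?X \<inter> ?Y))"
        using ia ib finJ by simp
      show False
        using u v Ja(2) Jb(2) card_Un_Int[OF finX finY] card_Un_Int[OF finJ] by linarith
    qed
    then obtain c where c: "c \<in> A i" "\<And>J. J \<subseteq> I \<Longrightarrow> card J \<le> card (\<Union>(R c ` J))"
      using i by blast
    obtain f where "inj_on f I" "\<forall>j\<in>I. f j \<in> R c j"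
      using less.hyps[OF small[OF c(1)] Rfin c(2)] by blast
    then show ?thesis using R_sub by blast
  qed
qed

text \<open>By induction: delete a matched pair \<open>u\<close>, \<open>s u\<close> and match their \<open>t\<close>-partners with each other.\<close>

lemma two_matchings_bipartite:
  fixes s t :: "'a \<Rightarrow> 'a"
  assumes "finite P"
    and "\<And>p. p \<in> P \<Longrightarrow> s p \<in> P \<and> s (s p) = p \<and> s p \<noteq> p"
    and "\<And>p. p \<in> P \<Longrightarrow> t p \<in> P \<and> t (t p) = p \<and> t p \<noteq> p"
  shows "\<exists>h. \<forall>p\<in>P. h (s p) = (\<not> h p) \<and> h (t p) = (\<not> h p)"
  using assms
proof (induction "card P" arbitrary: P t rule: less_induct)
  case less
  note S = less.prems(2) and T = less.prems(3)
  show ?case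
  proof (cases "P = {}")
    case False
    then obtain u where u: "u \<in> P" by blast
    define v where "v = s u"
    define Q where "Q = P - {u, v}"
    have v: "v \<in> P" "s v = u" "v \<noteq> u" using S[OF u] by (auto simp: v_def)
    have QP: "card Q < card P"
      unfolding Q_def using u less.prems(1) by (intro psubset_card_mono) auto
    have fQ: "finite Q" unfolding Q_def using less.prems(1) by simp
    have sQ: "s p \<in> Q \<and> s (s p) = p \<and> s p \<noteq> p" if "p \<in> Q" for p
      using S[of p] that v S[OF u] unfolding Q_def v_def by auto
    show ?thesis
    proof (cases "t u = v")
      case True
      have tv: "t v = u" using T[OF u] True by auto
      have tQ: "t p \<in> Q \<and> t (t p) = p \<and> t p \<noteq> p" if "p \<in> Q" for p
        using T[of p] that True tv unfolding Q_def by auto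
      obtain h where h: "\<forall>p\<in>Q. h (s p) = (\<not> h p) \<and> h (t p) = (\<not> h p)"
        using less.hyps[OF QP fQ sQ tQ] by blast
      have "\<forall>p\<in>P. (h(u := True, v := False)) (s p) = (\<not> (h(u := True, v := False)) p)
                \<and> (h(u := True, v := False)) (t p) = (\<not> (h(u := True, v := False)) p)"
      proof
        fix p assume p: "p \<in> P"
        then consider "p = u" | "p = v" | "p \<in> Q" unfolding Q_def by blast
        then show "(h(u := True, v := False)) (s p) = (\<not> (h(u := True, v := False)) p)
                \<and> (h(u := True, v := False)) (t p) = (\<not> (h(u := True, v := False)) p)"
        proof cases
          case 3
          then show ?thesis using bspec[OF h 3] sQ[OF 3] tQ[OF 3] unfolding Q_def by auto
        qed (use v v_def True tv in auto)
      qed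
      then show ?thesis by blast
    next
      case False
      define a b where "a = t u" and "b = t v"
      have a: "a \<in> Q" "t a = u" using T[OF u] False unfolding Q_def a_def by auto
      have b: "b \<in> Q" "t b = v" using T[OF v(1)] T[OF u] False unfolding Q_def b_def by auto
      have ab: "a \<noteq> b" using a(2) b(2) v(3) by auto
      \<comment> \<open>The path \<open>a\<close>, \<open>u\<close>, \<open>v\<close>,
        \<open>b\<close> is shortcut to an edge from \<open>a\<close> to \<open>b\<close>. These
        then get different colours, and \<open>u\<close> and \<open>v\<close> take those of
        \<open>b\<close> and \<open>a\<close>.\<close>
      define t' where "t' = t(a := b, b := a)"
      have tQ: "t' p \<in> Q \<and> t' (t' p) = p \<and> t' p \<noteq> p" if p: "p \<in> Q" for p
      proof -
        consider "p = a" | "p = b" | "p \<noteq> a" "p \<noteq> b" by blast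
        then show ?thesis
        proof cases
          case 3
          have tp: "t p \<in> P" "t (t p) = p" "t p \<noteq> p" using T[of p] p unfolding Q_def by auto
          have "t p \<noteq> u" "t p \<noteq> v" "t p \<noteq> a" "t p \<noteq> b"
            using 3 tp(2) a b p unfolding a_def b_def Q_def by auto
          then show ?thesis using 3 tp unfolding t'_def Q_def by auto
        qed (use a b ab in \<open>auto simp: t'_def\<close>)
      qed
      obtain h where h: "\<forall>p\<in>Q. h (s p) = (\<not> h p) \<and> h (t' p) = (\<not> h p)"
        using less.hyps[OF QP fQ sQ tQ] by blast
      have hab: "h b = (\<not> h a)" using bspec[OF h a(1)] ab by (simp add: t'_def)
      define k where "k = h(u := h b, v := h a)"
      have ku: "k u = h b" and kv: "k v = h a" and kQ: "p \<in> Q \<Longrightarrow> k p = h p" for p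
        using v(3) by (auto simp: k_def Q_def)
      have "\<forall>p\<in>P. k (s p) = (\<not> k p) \<and> k (t p) = (\<not> k p)"
      proof
        fix p assume p: "p \<in> P"
        then consider "p = u" | "p = v" | "p = a" | "p = b" | "p \<in> Q" "p \<noteq> a" "p \<noteq> b"
          unfolding Q_def by blast
        then show "k (s p) = (\<not> k p) \<and> k (t p) = (\<not> k p)"
        proof cases
          case 1
          then show ?thesis using ku kv kQ[OF a(1)] hab v_def a_def by auto
        next
          case 2
          then show ?thesis using ku kv kQ[OF b(1)] hab v(2) b_def by auto
        next
          case 3
          then show ?thesis using ku a(2) kQ[OF a(1)] hab bspec[OF h a(1)] kQ[of "s a"] sQ[OF a(1)] by auto
        next
          case 4
          then show ?thesis using kv b(2) kQ[OF b(1)] hab bspec[OF h b(1)] kQ[of "s b"] sQ[OF b(1)] by auto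
        next
          case 5
          have "t p = t' p" using 5 by (simp add: t'_def)
          then show ?thesis
            using bspec[OF h 5(1)] kQ[OF 5(1)] kQ[of "s p"] kQ[of "t p"] sQ[OF 5(1)] tQ[OF 5(1)] by auto
        qed
      qed
      then show ?thesis by blast
    qed
  qed simp
qed

subsection \<open>A packing that meets every triangle\<close>

text \<open>\<open>low_neighbour\<close> is 2-saturation: the three neighbours of a cubic vertex are
  not all cubic. \<open>cubic_in_triangle\<close> is what local girth 3 at cubic vertices
  provides.\<close>

locale saturated_cubic =
  fixes V :: "'a set" and E :: "'a \<Rightarrow> 'a \<Rightarrow> bool"
  assumes finite_V: "finite V"
    and adj_V: "E u v \<Longrightarrow> u \<in> V"
    and adj_sym: "E u v \<Longrightarrow> E v u"
    and adj_irrefl: "\<not> E v v"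
    and deg_le_3: "card {w. E v w} \<le> 3"
    and low_neighbour: "card {w. E v w} = 3 \<Longrightarrow> \<exists>w. E v w \<and> card {x. E w x} \<le> 2"
    and cubic_in_triangle: "card {w. E v w} = 3 \<Longrightarrow> \<exists>a b. E v a \<and> E v b \<and> E a b"
begin

definition low :: "'a \<Rightarrow> bool" where
  "low v \<longleftrightarrow> card {w. E v w} \<le> 2"

lemma finite_nbrs: "finite {w. E v w}"
  by (rule finite_subset[OF _ finite_V]) (use adj_V adj_sym in blast)

lemma not_low_iff: "\<not> low v \<longleftrightarrow> card {w. E v w} = 3"
  using deg_le_3[of v] by (auto simp: low_def)

lemma not_lowI:
  assumes "E v a" "E v b" "E v c" "a \<noteq> b" "a \<noteq> c" "b \<noteq> c"
  shows "\<not> low v"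
proof -
  have "card {a, b, c} \<le> card {w. E v w}"
    using assms by (intro card_mono finite_nbrs) auto
  then show ?thesis using assms by (simp add: low_def)
qed

lemma cubic_nbrs:
  assumes "E v a" "E v b" "E v c" "a \<noteq> b" "a \<noteq> c" "b \<noteq> c" "E v w"
  shows "w = a \<or> w = b \<or> w = c"
proof -
  have "{a, b, c} = {w. E v w}"
    using assms deg_le_3[of v] by (intro card_seteq finite_nbrs) auto
  then show ?thesis using assms(7) by blast
qed

lemma some_low:
  assumes "E v a" "E v b" "E v c" "a \<noteq> b" "a \<noteq> c" "b \<noteq> c"
  shows "low a \<or> low b \<or> low c"
  using not_lowI[OF assms] low_neighbour[of v] cubic_nbrs[OF assms]
  unfolding not_low_iff by (metis low_def)

lemma third_nbr:
  assumes "\<not> low v"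
  obtains c where "E v c" "c \<noteq> a" "c \<noteq> b"
proof -
  have "\<not> {w. E v w} \<subseteq> {a, b}"
  proof
    assume "{w. E v w} \<subseteq> {a, b}"
    then have "card {w. E v w} \<le> card {a, b}" by (intro card_mono) auto
    also have "\<dots> \<le> 2" by (simp add: card_insert_if)
    finally show False using assms by (simp add: low_def)
  qed
  then show ?thesis using that by blast
qed

section \<open>Triangles, diamonds and good vertices\<close>

definition triangle :: "'a set \<Rightarrow> bool" where
  "triangle t \<longleftrightarrow> (\<exists>x y z. t = {x, y, z} \<and> E x y \<and> E x z \<and> E y z)"

lemma triangleI: "E x y \<Longrightarrow> E x z \<Longrightarrow> E y z \<Longrightarrow> triangle {x, y, z}"
  unfolding triangle_def by blast

lemma triangle_at:
  assumes "triangle t" "x \<in> t"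
  obtains y z where "t = {x, y, z}" "E x y" "E x z" "E y z" "x \<noteq> y" "x \<noteq> z" "y \<noteq> z"
proof -
  obtain a b c where t: "t = {a, b, c}" "E a b" "E a c" "E b c"
    using assms(1) unfolding triangle_def by blast
  have s: "E b a" "E c a" "E c b" using t adj_sym by blast+
  have "\<exists>y z. t = {x, y, z} \<and> E x y \<and> E x z \<and> E y z"
    using assms(2) t s unfolding t(1)
    by (elim insertE emptyE) (metis insert_commute)+
  then show ?thesis using that adj_irrefl by metis
qed

lemma triangle_adj: "triangle t \<Longrightarrow> x \<in> t \<Longrightarrow> y \<in> t \<Longrightarrow> x \<noteq> y \<Longrightarrow> E x y"
  by (metis triangle_at insertE singletonD)

lemma triangle_subset: "triangle t \<Longrightarrow> t \<subseteq> V"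
  by (metis triangle_at adj_V subsetI)

text \<open>The degree-2 vertices of an isolated triangle and the two central vertices of a diamond are good.\<close>

definition good :: "'a \<Rightarrow> bool" where
  "good v \<longleftrightarrow> (\<forall>w. E v w \<longrightarrow> (\<exists>t. triangle t \<and> v \<in> t \<and> w \<in> t))
     \<and> (\<forall>t t'. triangle t \<longrightarrow> triangle t' \<longrightarrow> v \<in> t \<longrightarrow> t \<inter> t' \<noteq> {} \<longrightarrow> v \<in> t')"

lemma diamond_centre_good:
  assumes E: "E x y" "E x z" "E y z" "E x w" "E y w" and "z \<noteq> w"
  shows "good x"
proof -
  have ne: "x \<noteq> y" "x \<noteq> z" "x \<noteq> w" "y \<noteq> z" "y \<noteq> w" using E adj_irrefl by blast+
  have s: "E y x" "E z x" "E z y" "E w x" "E w y" using E adj_sym by blast+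
  have Nx: "q = y \<or> q = z \<or> q = w" if "E x q" for q
    using cubic_nbrs[of x y z w q] E ne assms(6) that by blast
  have Ny: "q = x \<or> q = z \<or> q = w" if "E y q" for q
    using cubic_nbrs[of y x z w q] E s ne assms(6) that by blast
  \<comment> \<open>Saturation excludes a complete graph on four vertices. Hence a triangle through
    \<open>y\<close> is not \<open>{y, z, w}\<close> and contains \<open>x\<close>.\<close>
  have zw: "\<not> E z w"
  proof
    assume "E z w"
    then have "\<not> low z" "\<not> low w" "\<not> low y"
      using not_lowI[of z x y w] not_lowI[of w x y z] not_lowI[of y x z w] E s ne assms(6) adj_sym
      by blast+
    then show False using some_low[of x y z w] E ne assms(6) by blast
  qed
  have ty: "x \<in> t" if t: "triangle t" "y \<in> t" for t
  proof -
    obtain a b where "t = {y, a, b}" "E y a" "E y b" "E a b" "a \<noteq> b"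
      using triangle_at[OF t] by metis
    then show ?thesis using Ny[of a] Ny[of b] zw adj_sym by blast
  qed
  have tz: "x \<in> t" if t: "triangle t" "q \<in> t" "E q x" "E q y" for t q
  proof (rule ccontr)
    assume x: "x \<notin> t"
    then have y: "y \<notin> t" using ty t by blast
    obtain a b where "t = {q, a, b}" "E q a" "E q b" "a \<noteq> b"
      using triangle_at[OF t(1,2)] by metis
    then show False using cubic_nbrs[of q x y a b] t x y ne by blast
  qed
  have "\<exists>t. triangle t \<and> x \<in> t \<and> q \<in> t" if "E x q" for q
    using Nx[OF that] triangleI[of x y z] triangleI[of x y w] E by blast
  moreover have "x \<in> t'" if t: "triangle t" "triangle t'" "x \<in> t" "t \<inter> t' \<noteq> {}" for t t'
  proof -
    obtain q where q: "q \<in> t" "q \<in> t'" using t by blast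
    then consider "q = x" | "q = y" | "q = z" | "q = w"
      using triangle_adj[OF t(1,3), of q] Nx by blast
    then show ?thesis using q t(2) ty tz s by cases blast+
  qed
  ultimately show ?thesis unfolding good_def by blast
qed

text \<open>The common vertex has at most three neighbours, so the triangles share an edge and it is
  the centre of a diamond.\<close>

lemma meeting_triangles_good:
  assumes "triangle t" "triangle t'" "t \<noteq> t'" "t \<inter> t' \<noteq> {}"
  shows "\<exists>g\<in>t. good g"
proof -
  obtain x where x: "x \<in> t" "x \<in> t'" using assms by blast
  obtain a b where t: "t = {x, a, b}" "E x a" "E x b" "E a b" "a \<noteq> b"
    using triangle_at[OF assms(1) x(1)] by metis
  obtain c d where t': "t' = {x, c, d}" "E x c" "E x d" "E c d" "c \<noteq> d"
    using triangle_at[OF assms(2) x(2)] by metis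
  have s: "E b a" "E d c" using t t' adj_sym by blast+
  have "c = a \<or> c = b \<or> d = a \<or> d = b"
    using cubic_nbrs[of x a b c d] t t' by blast
  then consider "c = a" "b \<noteq> d" | "c = b" "a \<noteq> d" | "d = a" "b \<noteq> c" | "d = b" "a \<noteq> c"
    using assms(3) t(1) t'(1) by (metis insert_commute)
  then have "good x"
    using diamond_centre_good[of x a b d] diamond_centre_good[of x b a d]
      diamond_centre_good[of x a b c] diamond_centre_good[of x b a c] t t' s
    by cases blast+
  then show ?thesis using x by blast
qed

lemma low_triangle_good:
  assumes t: "triangle t" "x \<in> t" and "low x"
  shows "\<exists>g\<in>t. good g"
proof (cases "\<exists>t'. triangle t' \<and> t' \<noteq> t \<and> t \<inter> t' \<noteq> {}")
  case True
  then show ?thesis using meeting_triangles_good[OF t(1)] by blast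
next
  case False
  then have iso: "triangle t' \<Longrightarrow> t \<inter> t' \<noteq> {} \<Longrightarrow> t' = t" for t' by blast
  obtain y z where "t = {x, y, z}" "E x y" "E x z" "y \<noteq> z"
    using triangle_at[OF t] by metis
  then have "w \<in> t" if "E x w" for w
    using not_lowI[of x y z w] assms(3) that by blast
  then have "good x" unfolding good_def using iso t by blast
  then show ?thesis using t(2) by blast
qed

text \<open>These triangles need a matched outer neighbour. Each is disjoint from all other
  triangles, and its vertices are cubic.\<close>

definition bare :: "'a set \<Rightarrow> bool" where
  "bare t \<longleftrightarrow> triangle t \<and> (\<forall>g\<in>t. \<not> good g)"

lemma bare_triangle: "bare t \<Longrightarrow> triangle t"
  by (simp add: bare_def)

lemma bare_iso: "bare t \<Longrightarrow> triangle t' \<Longrightarrow> x \<in> t \<Longrightarrow> x \<in> t' \<Longrightarrow> t' = t"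
  using meeting_triangles_good[of t t'] unfolding bare_def by blast

lemma bare_not_low: "bare t \<Longrightarrow> x \<in> t \<Longrightarrow> \<not> low x"
  using low_triangle_good unfolding bare_def by blast

lemma bare_outer_unique:
  assumes "bare t" "x \<in> t" "E x p" "p \<notin> t" "E x q" "q \<notin> t"
  shows "p = q"
proof -
  obtain y z where "t = {x, y, z}" "E x y" "E x z" "y \<noteq> z"
    using triangle_at[OF bare_triangle[OF assms(1)] assms(2)] by metis
  then show ?thesis using cubic_nbrs[of x y z p q] assms by blast
qed

text \<open>The two neighbours of \<open>x\<close> in the triangle are cubic, so saturation forces
  \<open>p\<close> to be low.\<close>

lemma bare_outer_low:
  assumes "bare t" "x \<in> t" "E x p" "p \<notin> t"
  shows "low p"
proof -
  obtain y z where "t = {x, y, z}" "E x y" "E x z" "y \<noteq> z"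
    using triangle_at[OF bare_triangle[OF assms(1)] assms(2)] by metis
  then show ?thesis using some_low[of x y z p] assms bare_not_low[OF assms(1)] by blast
qed

lemma bare_outer_exists:
  assumes "bare t" "x \<in> t"
  shows "\<exists>p. E x p \<and> p \<notin> t"
proof -
  obtain y z where t: "t = {x, y, z}"
    using triangle_at[OF bare_triangle[OF assms(1)] assms(2)] by metis
  obtain p where "E x p" "p \<noteq> y" "p \<noteq> z" using third_nbr[OF bare_not_low[OF assms]] .
  then show ?thesis using t adj_irrefl by blast
qed

lemma bare_outer_inj:
  assumes "bare t" "x \<in> t" "y \<in> t" "E x p" "E y p" "p \<notin> t"
  shows "x = y"
proof (rule ccontr)
  assume "x \<noteq> y"
  then have "triangle {x, y, p}"
    using assms triangle_adj[OF bare_triangle] by (intro triangleI) auto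
  then show False using bare_iso[OF assms(1) _ assms(2)] assms(6) by blast
qed

section \<open>Outer neighbours and Hall's condition\<close>

definition outer :: "'a set \<Rightarrow> 'a set" where
  "outer t = {p. p \<notin> t \<and> (\<exists>x\<in>t. E x p)}"

lemma finite_outer: "finite (outer t)"
  unfolding outer_def by (rule finite_subset[OF _ finite_V]) (use adj_V adj_sym in blast)

lemma card_outer:
  assumes "bare t"
  shows "card (outer t) = 3"
proof -
  obtain h where h: "\<And>x. x \<in> t \<Longrightarrow> E x (h x) \<and> h x \<notin> t"
    using bare_outer_exists[OF assms] by metis
  have "outer t = h ` t"
    using h bare_outer_unique[OF assms] unfolding outer_def by blast
  moreover have "inj_on h t"
    using h bare_outer_inj[OF assms] by (metis inj_onI)
  moreover have "card t = 3"
    using bare_triangle[OF assms] adj_irrefl unfolding triangle_def by (metis card_3_iff)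
  ultimately show ?thesis by (simp add: card_image)
qed

text \<open>Distinct bare triangles are disjoint, hence reach \<open>p\<close> through distinct
  neighbours of \<open>p\<close>, of which there are at most two.\<close>

lemma outer_sharing:
  assumes "low p" "\<And>t. t \<in> J \<Longrightarrow> bare t"
  shows "card {t\<in>J. p \<in> outer t} \<le> 2"
proof -
  have "\<forall>t\<in>{t\<in>J. p \<in> outer t}. \<exists>x\<in>t. E p x"
    using adj_sym unfolding outer_def by blast
  then obtain k where k: "\<And>t. t \<in> J \<Longrightarrow> p \<in> outer t \<Longrightarrow> k t \<in> t \<and> E p (k t)"
    by (metis (no_types, lifting) mem_Collect_eq)
  have "inj_on k {t\<in>J. p \<in> outer t}"
    using k assms(2) bare_iso bare_triangle by (intro inj_onI) (metis (no_types, lifting) mem_Collect_eq)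
  then have "card {t\<in>J. p \<in> outer t} \<le> card {w. E p w}"
    by (rule card_inj_on_le) (use k finite_nbrs in auto)
  then show ?thesis using assms(1) by (simp add: low_def)
qed

text \<open>Double counting: each triangle has three outer neighbours, and each of these is shared
  by at most two triangles, which implies Hall's condition.\<close>

lemma outer_sdr: "\<exists>f. inj_on f {t. bare t} \<and> (\<forall>t\<in>{t. bare t}. f t \<in> outer t)"
proof (rule hall_sdr)
  have sub: "{t. bare t} \<subseteq> Pow V" using bare_triangle triangle_subset by blast
  then show "finite {t. bare t}" using finite_V by (meson finite_Pow_iff finite_subset)
  show "finite (outer t)" for t by (rule finite_outer)
  show "card J \<le> card (\<Union>(outer ` J))" if J: "J \<subseteq> {t. bare t}" for J
  proof -
    let ?U = "\<Union>(outer ` J)"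
    have finJ: "finite J" using J sub finite_V by (meson finite_Pow_iff finite_subset)
    then have finU: "finite ?U" using finite_outer by blast
    have "3 * card J = (\<Sum>t\<in>J. card {p\<in>?U. p \<in> outer t})"
    proof -
      have "card {p\<in>?U. p \<in> outer t} = 3" if "t \<in> J" for t
      proof -
        have "{p\<in>?U. p \<in> outer t} = outer t" using that by blast
        then show ?thesis using card_outer J that by auto
      qed
      then show ?thesis by simp
    qed
    also have "\<dots> = (\<Sum>p\<in>?U. card {t\<in>J. p \<in> outer t})"
      by (rule sum_multicount_gen[OF finJ finU]) simp
    also have "\<dots> \<le> (\<Sum>p\<in>?U. 2)"
    proof (rule sum_mono)
      fix p assume "p \<in> ?U"
      then have "low p" using J bare_outer_low unfolding outer_def by blast
      then show "card {t\<in>J. p \<in> outer t} \<le> 2" using J by (intro outer_sharing) auto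
    qed
    finally show ?thesis by simp
  qed
qed

section \<open>Packings: no two vertices at distance 1 or 2\<close>

definition near :: "'a \<Rightarrow> 'a \<Rightarrow> bool" where
  "near u v \<longleftrightarrow> u \<noteq> v \<and> (E u v \<or> (\<exists>m. E u m \<and> E m v))"

lemma near_sym: "near u v \<Longrightarrow> near v u"
  unfolding near_def using adj_sym by blast

lemma near_irrefl: "\<not> near v v"
  by (simp add: near_def)

definition packing :: "'a set \<Rightarrow> bool" where
  "packing S \<longleftrightarrow> S \<subseteq> V \<and> (\<forall>u\<in>S. \<forall>v\<in>S. \<not> near u v)"

text \<open>The edges joining \<open>u\<close> to \<open>v\<close> lie in triangles that meet, and
  the second clause of \<open>good\<close> passes membership along. So near good vertices hit the
  same triangles.\<close>

lemma near_good_same_triangles: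
  assumes "good u" "good v" "near u v" "triangle t" "v \<in> t"
  shows "u \<in> t"
proof -
  have "\<exists>t t'. triangle t \<and> triangle t' \<and> u \<in> t \<and> v \<in> t' \<and> t \<inter> t' \<noteq> {}"
  proof (cases "E u v")
    case True
    then show ?thesis using assms(1) unfolding good_def by blast
  next
    case False
    then obtain m where "E u m" "E v m" using assms(3) adj_sym unfolding near_def by blast
    then show ?thesis using assms(1,2) unfolding good_def by blast
  qed
  then show ?thesis using assms(1,2,4,5) unfolding good_def by blast
qed

text \<open>A maximal packing of good vertices works: a good vertex that cannot be added is near a
  member, which then lies in the same triangles.\<close>

lemma good_packing_exists:
  "\<exists>S. packing S \<and> (\<forall>g\<in>S. good g) \<and> (\<forall>t. triangle t \<longrightarrow> (\<exists>g\<in>t. good g) \<longrightarrow> t \<inter> S \<noteq> {})"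
proof -
  define F where "F = {S. packing S \<and> (\<forall>g\<in>S. good g)}"
  have "F \<subseteq> Pow V" by (auto simp: F_def packing_def)
  then have "finite F" using finite_V by (meson finite_Pow_iff finite_subset)
  moreover have "F \<noteq> {}" unfolding F_def packing_def by blast
  ultimately obtain S where SF: "S \<in> F" and max: "\<forall>S'\<in>F. S \<subseteq> S' \<longrightarrow> S = S'"
    using finite_has_maximal[of F] by auto
  then have S: "packing S" "\<forall>g\<in>S. good g" by (auto simp: F_def)
  have "t \<inter> S \<noteq> {}" if t: "triangle t" "g \<in> t" "good g" for t g
  proof (cases "\<exists>u\<in>S. near u g")
    case True
    then show ?thesis using near_good_same_triangles[of _ g t] t S by blast
  next
    case False
    then have "packing (insert g S)"
      using S(1) near_sym near_irrefl triangle_subset[OF t(1)] t(2) unfolding packing_def by blast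
    then have "insert g S \<in> F" using S(2) t(3) unfolding F_def by blast
    then have "insert g S = S" using max by blast
    then show ?thesis using t(2) by blast
  qed
  then show ?thesis using S by blast
qed

lemma triangle_transversal_packing:
  "\<exists>S. packing S \<and> (\<forall>t. triangle t \<longrightarrow> t \<inter> S \<noteq> {})"
proof -
  obtain S where S: "packing S" "\<And>g. g \<in> S \<Longrightarrow> good g"
    "\<And>t g. triangle t \<Longrightarrow> g \<in> t \<Longrightarrow> good g \<Longrightarrow> t \<inter> S \<noteq> {}"
    using good_packing_exists by blast
  obtain f where f: "inj_on f {t. bare t}" "\<And>t. bare t \<Longrightarrow> f t \<in> outer t"
    using outer_sdr by blast
  then have "\<forall>t\<in>{t. bare t}. \<exists>x\<in>t. E x (f t)" unfolding outer_def by blast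
  then obtain r where r: "\<And>t. bare t \<Longrightarrow> r t \<in> t \<and> E (r t) (f t)"
    by (metis mem_Collect_eq)
  have fo: "f t \<notin> t" if "bare t" for t using f(2)[OF that] unfolding outer_def by blast
  have fu: "q = f t" if "bare t" "E (r t) q" "q \<notin> t" for t q
    using bare_outer_unique[of t "r t" q "f t"] r[OF that(1)] fo that by blast
  have bg: "\<not> near (r t) g" if b: "bare t" and g: "good g" for t g
  proof
    assume n: "near (r t) g"
    have gt: "g \<notin> t" using b g unfolding bare_def by blast
    have no: "\<not> E g q" if "q \<in> t" for q
    proof
      assume "E g q"
      then obtain t' where "triangle t'" "g \<in> t'" "q \<in> t'" using g unfolding good_def by blast
      then show False using bare_iso[OF b _ that] gt by blast
    qed
    then obtain m where m: "E (r t) m" "E m g" "m \<notin> t"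
      using n r[OF b] adj_sym unfolding near_def by blast
    obtain t' where t': "triangle t'" "g \<in> t'" "m \<in> t'"
      using g m(2) adj_sym unfolding good_def by blast
    \<comment> \<open>The outer neighbour \<open>m\<close> is low and has two neighbours in
      \<open>t'\<close>, so \<open>r t\<close> is one of them, although \<open>t\<close> meets no
      other triangle.\<close>
    have lm: "low m" using bare_outer_low[OF b _ m(1,3)] r[OF b] by blast
    obtain c d where cd: "t' = {m, c, d}" "E m c" "E m d" "c \<noteq> d"
      using triangle_at[OF t'(1,3)] by metis
    then have "r t \<in> t'" using not_lowI[of m c d "r t"] lm adj_sym[OF m(1)] by blast
    then show False using bare_iso[OF b t'(1)] r[OF b] t'(2) gt by blast
  qed
  \<comment> \<open>Bare triangles are not adjacent, since outer neighbours are low and bare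
    vertices are not. A common neighbour would be \<open>f t\<close> for both triangles.\<close>
  have bb: "\<not> near (r t) (r t')" if b: "bare t" and b': "bare t'" for t t'
  proof
    assume n: "near (r t) (r t')"
    then have ne: "t \<noteq> t'" unfolding near_def by blast
    then have dis: "q \<notin> t'" if "q \<in> t" for q
      using bare_iso[OF b' bare_triangle[OF b]] that by blast
    have no: "\<not> E p q" if "p \<in> t" "q \<in> t'" for p q
      using bare_outer_low[OF b that(1), of q] dis bare_not_low[OF b' that(2)] that by blast
    then obtain m where m: "E (r t) m" "E m (r t')"
      using n r[OF b] r[OF b'] unfolding near_def by blast
    then have "m \<notin> t" "m \<notin> t'" using no r[OF b] r[OF b'] adj_sym by blast+
    then have "m = f t" "m = f t'" using fu b b' m adj_sym by blast+
    then show False using f(1) ne b b' by (auto dest: inj_onD)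
  qed
  let ?S = "S \<union> r ` {t. bare t}"
  have "packing ?S"
    unfolding packing_def
  proof (intro conjI ballI)
    show "?S \<subseteq> V" using S(1) r bare_triangle triangle_subset unfolding packing_def by blast
    fix u v assume "u \<in> ?S" "v \<in> ?S"
    then show "\<not> near u v"
      using S(1,2) bg bb near_sym unfolding packing_def by blast
  qed
  moreover have "t \<inter> ?S \<noteq> {}" if "triangle t" for t
    using S(3)[OF that] r[of t] that unfolding bare_def by blast
  ultimately show ?thesis by blast
qed

end

subsection \<open>Removing monochromatic edges\<close>

context saturated_cubic
begin

definition valid :: "'a set \<Rightarrow> bool" where
  "valid S \<longleftrightarrow> packing S \<and> (\<forall>t. triangle t \<longrightarrow> t \<inter> S \<noteq> {})"

lemma valid_not_near: "valid S \<Longrightarrow> u \<in> S \<Longrightarrow> v \<in> S \<Longrightarrow> \<not> near u v"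
  by (simp add: valid_def packing_def)

text \<open>A cubic vertex outside \<open>S\<close> lies on a triangle, and \<open>S\<close> meets
  this triangle in one of its neighbours.\<close>

lemma valid_residual_degree:
  assumes "valid S" "v \<notin> S" "E v a" "E v b" "E v c" "a \<notin> S" "b \<notin> S" "c \<notin> S"
  shows "a = b \<or> a = c \<or> b = c"
proof (rule ccontr)
  assume d: "\<not> ?thesis"
  then have "card {w. E v w} = 3"
    using not_lowI[of v a b c] assms not_low_iff by blast
  then obtain x y where xy: "E v x" "E v y" "E x y" using cubic_in_triangle by blast
  then have "x \<notin> S" "y \<notin> S" using cubic_nbrs[of v a b c] assms d by blast+
  then show False using triangleI[OF xy] assms(1,2) unfolding valid_def by blast
qed

definition mono_arcs :: "'a set \<Rightarrow> ('a \<Rightarrow> bool) \<Rightarrow> ('a \<times> 'a) set" where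
  "mono_arcs S f = {(u, v). E u v \<and> u \<notin> S \<and> v \<notin> S \<and> f u = f v}"

lemma mono_arcs_iff: "(u, v) \<in> mono_arcs S f \<longleftrightarrow> E u v \<and> u \<notin> S \<and> v \<notin> S \<and> f u = f v"
  by (simp add: mono_arcs_def)

lemma mono_arcs_sym: "(u, v) \<in> mono_arcs S f \<Longrightarrow> (v, u) \<in> mono_arcs S f"
  using adj_sym by (auto simp: mono_arcs_iff)

lemma finite_mono_arcs: "finite (mono_arcs S f)"
  by (rule finite_subset[of _ "V \<times> V"]) (use adj_V adj_sym finite_V in \<open>fastforce simp: mono_arcs_iff\<close>)+

end

text \<open>No colouring is fixed: \<open>n\<close> bounds all valid sets with all colourings, and
  \<open>P\<close> uses every colouring of \<open>S\<close> that attains \<open>n\<close>.\<close>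

locale minimal_packing = saturated_cubic +
  fixes S :: "'a set" and n :: nat
  assumes valid_S: "valid S"
    and min: "valid S' \<Longrightarrow> n \<le> card (mono_arcs S' f)"
begin

lemma no_improvement:
  assumes "valid S'" "card (mono_arcs S f) = n" "mono_arcs S' g \<subset> mono_arcs S f"
  shows False
  using psubset_card_mono[OF finite_mono_arcs assms(3)] min[OF assms(1), of g] assms(2) by simp

section \<open>Optimal colourings and the set \<open>P\<close>\<close>

definition P :: "'a set" where
  "P = {p. \<exists>f u. card (mono_arcs S f) = n \<and> (p, u) \<in> mono_arcs S f}"

lemma P_not_S: "p \<in> P \<Longrightarrow> p \<notin> S"
  by (auto simp: P_def mono_arcs_iff)

lemma P_V: "p \<in> P \<Longrightarrow> p \<in> V"
  using adj_V by (auto simp: P_def mono_arcs_iff)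

text \<open>Flipping \<open>p\<close> repairs the edge to \<open>u\<close>, and at most one further
  neighbour of \<open>p\<close> is outside \<open>S\<close>. By minimality the edge to that
  neighbour exists and is monochromatic in exchange.\<close>

lemma recolour_moves_mono:
  assumes n: "card (mono_arcs S f) = n" and pu: "(p, u) \<in> mono_arcs S f"
  shows "\<exists>w g. w \<noteq> u \<and> E p w \<and> w \<notin> S \<and> card (mono_arcs S g) = n \<and> (p, w) \<in> mono_arcs S g"
proof -
  let ?g = "f(p := \<not> f p)"
  have pu': "E p u" "p \<notin> S" "u \<notin> S" "f u = f p" using pu by (auto simp: mono_arcs_iff)
  have pp: "p \<noteq> u" using pu' adj_irrefl by blast
  show ?thesis
  proof (cases "\<exists>w. w \<noteq> u \<and> E p w \<and> w \<notin> S \<and> f w \<noteq> f p")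
    case True
    then obtain w where w: "w \<noteq> u" "E p w" "w \<notin> S" "f w \<noteq> f p" by blast
    have wp: "w \<noteq> p" using w adj_irrefl by blast
    have pn: "q = u \<or> q = w" if "E p q" "q \<notin> S" for q
      using valid_residual_degree[OF valid_S pu'(2), of u w q] pu' w that by blast
    have "mono_arcs S ?g \<subseteq> (mono_arcs S f - {(p, u), (u, p)}) \<union> {(p, w), (w, p)}"
    proof (rule subrelI)
      fix x y assume xy: "(x, y) \<in> mono_arcs S ?g"
      then have xy': "E x y" "x \<notin> S" "y \<notin> S" "?g x = ?g y" by (auto simp: mono_arcs_iff)
      consider "x = p" | "y = p" | "x \<noteq> p" "y \<noteq> p" by blast
      then show "(x, y) \<in> (mono_arcs S f - {(p, u), (u, p)}) \<union> {(p, w), (w, p)}"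
      proof cases
        case 1
        then show ?thesis using pn[of y] xy' pu' pp by auto
      next
        case 2
        then show ?thesis using pn[of x] xy' adj_sym pu' pp by auto
      next
        case 3
        then show ?thesis using xy' by (auto simp: mono_arcs_iff)
      qed
    qed
    then have "card (mono_arcs S ?g) \<le> card ((mono_arcs S f - {(p, u), (u, p)}) \<union> {(p, w), (w, p)})"
      by (intro card_mono) (auto simp: finite_mono_arcs)
    also have "\<dots> \<le> card (mono_arcs S f - {(p, u), (u, p)}) + card {(p, w), (w, p)}"
      by (rule card_Un_le)
    also have "\<dots> = card (mono_arcs S f) - card {(p, u), (u, p)} + card {(p, w), (w, p)}"
      using pu mono_arcs_sym[OF pu] by (subst card_Diff_subset) auto
    also have "\<dots> = card (mono_arcs S f)"
      using card_mono[OF finite_mono_arcs, of "{(p, u), (u, p)}" S f] pu mono_arcs_sym[OF pu] pp wp by simp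
    finally have "card (mono_arcs S ?g) = n" using min[OF valid_S, of ?g] n by simp
    moreover have "(p, w) \<in> mono_arcs S ?g" using w pu' wp by (auto simp: mono_arcs_iff)
    ultimately show ?thesis using w by blast
  next
    case False
    have "mono_arcs S ?g \<subseteq> mono_arcs S f"
    proof (rule subrelI)
      fix x y assume xy: "(x, y) \<in> mono_arcs S ?g"
      then have xy': "E x y" "E y x" "x \<notin> S" "y \<notin> S" "?g x = ?g y" "x \<noteq> y"
        using adj_sym adj_irrefl by (auto simp: mono_arcs_iff)
      then show "(x, y) \<in> mono_arcs S f"
        using False pu' pp by (cases "x = p"; cases "y = p") (auto simp: mono_arcs_iff)
    qed
    moreover have "(p, u) \<notin> mono_arcs S ?g" using pu' pp by (auto simp: mono_arcs_iff)
    ultimately show ?thesis using no_improvement[OF valid_S n, of ?g] pu by blast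
  qed
qed

text \<open>A monochromatic edge at \<open>p\<close> can be moved to a second edge at
  \<open>p\<close>, and the residual degree excludes a third one outside \<open>S\<close>.\<close>

lemma P_nbrs:
  assumes "p \<in> P"
  obtains u w where "u \<in> P" "w \<in> P" "u \<noteq> w" "E p u" "E p w"
    "\<And>q. E p q \<Longrightarrow> q \<notin> S \<Longrightarrow> q = u \<or> q = w"
proof -
  obtain f u where u: "card (mono_arcs S f) = n" "(p, u) \<in> mono_arcs S f" using assms by (auto simp: P_def)
  obtain w g where w: "w \<noteq> u" "E p w" "w \<notin> S" "card (mono_arcs S g) = n" "(p, w) \<in> mono_arcs S g"
    using recolour_moves_mono[OF u] by blast
  have uw: "u \<in> P" "w \<in> P" using u w mono_arcs_sym unfolding P_def by blast+
  have "E p u" "u \<notin> S" "p \<notin> S" using u by (auto simp: mono_arcs_iff)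
  then have "q = u \<or> q = w" if "E p q" "q \<notin> S" for q
    using valid_residual_degree[OF valid_S, of p u w q] w that by blast
  then show ?thesis using that[OF uw] w \<open>E p u\<close> by blast
qed

lemma P_closed: "p \<in> P \<Longrightarrow> E p q \<Longrightarrow> q \<notin> S \<Longrightarrow> q \<in> P"
  by (metis P_nbrs)

lemma P_adj_S_not_low:
  assumes "p \<in> P" "E p s" "s \<in> S"
  shows "\<not> low p"
proof -
  obtain u w where "u \<in> P" "w \<in> P" "u \<noteq> w" "E p u" "E p w" using P_nbrs[OF assms(1)] by metis
  then show ?thesis using not_lowI[of p u w s] assms P_not_S by blast
qed

text \<open>\<open>P\<close> is a union of components of the graph outside \<open>S\<close>, so
  exchanging the colours on it affects no edge.\<close>

lemma mono_flip_P: "mono_arcs S (\<lambda>x. if x \<in> P then \<not> f x else f x) = mono_arcs S f"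
proof -
  have "x \<in> P \<longleftrightarrow> y \<in> P" if "E x y" "x \<notin> S" "y \<notin> S" for x y
    using P_closed that adj_sym by blast
  then show ?thesis by (auto simp: mono_arcs_def)
qed

text \<open>Otherwise \<open>p\<close> could join \<open>S\<close>, which would remove a
  monochromatic edge.\<close>

lemma P_near_S:
  assumes "p \<in> P"
  shows "\<exists>s\<in>S. near p s"
proof (rule ccontr)
  assume no: "\<not> ?thesis"
  obtain f u where u: "card (mono_arcs S f) = n" "(p, u) \<in> mono_arcs S f" using assms by (auto simp: P_def)
  have "packing (insert p S)"
    using valid_S no near_sym near_irrefl P_V[OF assms] unfolding valid_def packing_def by blast
  then have "valid (insert p S)" using valid_S unfolding valid_def by blast
  moreover have "mono_arcs (insert p S) f \<subset> mono_arcs S f"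
    using u(2) by (auto simp: mono_arcs_def)
  ultimately show False using no_improvement[OF _ u(1)] by blast
qed

text \<open>Low vertices of \<open>P\<close> have no neighbour in \<open>S\<close>. If all
  neighbours of \<open>p\<close> were low as well, \<open>p\<close> would be at distance at least 3
  from \<open>S\<close>.\<close>

lemma low_P_has_cubic_nbr:
  assumes "p \<in> P" "low p"
  shows "\<exists>a\<in>P. E p a \<and> \<not> low a"
proof (rule ccontr)
  assume no: "\<not> ?thesis"
  have pn: "q \<in> P \<and> low q" if "E p q" for q
    using that no P_closed P_adj_S_not_low assms by blast
  obtain s where s: "s \<in> S" "near p s" using P_near_S[OF assms(1)] by blast
  then consider "E p s" | m where "E p m" "E m s" unfolding near_def by blast
  then show False
  proof cases
    case 1
    then show ?thesis using P_adj_S_not_low assms s by blast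
  next
    case 2
    then show ?thesis using P_adj_S_not_low pn s by blast
  qed
qed

text \<open>\<open>S\<close> meets a triangle at \<open>a\<close> in some \<open>s\<close>; its
  third vertex \<open>b\<close> is too close to \<open>s\<close> to be in \<open>S\<close>, hence
  lies in \<open>P\<close>.\<close>

lemma cubic_P_structure:
  assumes "a \<in> P" "\<not> low a"
  obtains s b c where "s \<in> S" "b \<in> P" "c \<in> P" "b \<noteq> c" "E a s" "E a b" "E a c" "E b s" "\<not> low b"
    "\<forall>q. E a q \<longrightarrow> q = s \<or> q = b \<or> q = c"
proof -
  obtain x y where xy: "E a x" "E a y" "E x y"
    using cubic_in_triangle assms(2) not_low_iff by blast
  have "x \<in> S \<or> y \<in> S"
    using triangleI[OF xy] valid_S P_not_S[OF assms(1)] unfolding valid_def by blast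
  then obtain s b where sb: "s \<in> S" "E a s" "E a b" "E b s" using xy adj_sym by blast
  have "near b s" using sb adj_irrefl unfolding near_def by blast
  then have "b \<notin> S" using valid_not_near[OF valid_S] sb by blast
  then have b: "b \<in> P" using P_closed[OF assms(1)] sb by blast
  obtain c where c: "c \<in> P" "c \<noteq> b" "E a c" using P_nbrs[OF assms(1)] by metis
  have "s \<noteq> b" "s \<noteq> c" using sb b c P_not_S by blast+
  then have "q = s \<or> q = b \<or> q = c" if "E a q" for q
    using cubic_nbrs[of a s b c q] sb c that by blast
  then show ?thesis
    using that[OF sb(1) b c(1) c(2)[symmetric] sb(2,3) c(3) sb(4)] P_adj_S_not_low[OF b sb(4,1)]
    by blast
qed

text \<open>Otherwise \<open>a\<close>, \<open>b\<close> and \<open>d\<close> would all be cubic, as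
  vertices of \<open>P\<close> adjacent to \<open>S\<close>, against saturation at
  \<open>s\<close>.\<close>

lemma P_triangle_third_low:
  assumes "a \<in> P" "b \<in> P" "s \<in> S" "E a s" "E b s" "a \<noteq> b" "E s d" "d \<noteq> a" "d \<noteq> b"
  shows "d \<notin> P"
proof
  assume d: "d \<in> P"
  have "\<not> low a" "\<not> low b" "\<not> low d"
    using P_adj_S_not_low assms d adj_sym by blast+
  then show False using some_low[of s a b d] assms adj_sym by blast
qed

text \<open>
  Here \<open>a\<close> replaces the vertex \<open>s\<close> of \<open>S\<close> in its triangle \<open>{a, b, s}\<close>. The vertex \<open>s\<close> can be
  coloured because its possible third neighbour is not in \<open>P\<close>: if that neighbour and \<open>b\<close> have
  different colours, all colours on \<open>P\<close> are exchanged first.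
\<close>

lemma cubic_P_low_nbr:
  assumes a: "a \<in> P" "\<not> low a" and p: "p \<in> P" "low p" "E a p"
  shows False
proof -
  obtain s b c where A: "s \<in> S" "b \<in> P" "c \<in> P" "b \<noteq> c" "E a s" "E a b" "E a c" "E b s" "\<not> low b"
    and "\<forall>q. E a q \<longrightarrow> q = s \<or> q = b \<or> q = c"
    by (rule cubic_P_structure[OF a])
  then have Na: "q = s \<or> q = b \<or> q = c" if "E a q" for q using that by blast
  have "p = c" using Na[OF p(3)] p A P_not_S by blast
  then have c: "low c" using p by blast
  have ne: "a \<noteq> b" "a \<noteq> s" "b \<noteq> s" using A adj_irrefl by blast+
  have sE: "E s a" "E s b" "E b a" using A adj_sym by blast+
  let ?S = "insert a (S - {s})"
  \<comment> \<open>Paths of length 2 through \<open>s\<close> or \<open>b\<close> lead to vertices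
    near \<open>s\<close>, and the low vertex \<open>c\<close> of \<open>P\<close> has no neighbour
    in \<open>S\<close>.\<close>
  have "\<not> near a v" if v: "v \<in> S" "v \<noteq> s" for v
  proof
    assume "near a v"
    then consider "E a v" | m where "E a m" "E m v" unfolding near_def by blast
    then show False
    proof cases
      case 1
      then show ?thesis using Na v A P_not_S by blast
    next
      case 2
      have sv: "\<not> near s v" using valid_not_near[OF valid_S A(1) v(1)] .
      consider "m = s" | "m = b" | "m = c" using Na[OF 2(1)] by blast
      then show ?thesis
      proof cases
        case 1
        then show ?thesis using sv 2(2) v(2) unfolding near_def by blast
      next
        case b: 2
        then show ?thesis using sv 2(2) v(2) sE(2) unfolding near_def by blast
      next
        case 3
        then show ?thesis using P_adj_S_not_low[OF A(3)] c 2(2) v(1) by blast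
      qed
    qed
  qed
  then have "packing ?S"
    using valid_S near_sym near_irrefl P_V[OF a(1)] unfolding valid_def packing_def by blast
  \<comment> \<open>A triangle that loses its vertex of \<open>S\<close> contains \<open>s\<close>
    but not \<open>a\<close>, hence \<open>b\<close> and a further vertex \<open>d\<close> of
    \<open>P\<close>, but \<open>s\<close> has no third neighbour in \<open>P\<close>.\<close>
  moreover have "t \<inter> ?S \<noteq> {}" if t: "triangle t" for t
  proof
    assume no: "t \<inter> ?S = {}"
    then have st: "s \<in> t" "a \<notin> t" using t valid_S unfolding valid_def by blast+
    obtain x y where xy: "t = {s, x, y}" "E s x" "E s y" "E x y" "x \<noteq> y"
      using triangle_at[OF t st(1)] by metis
    have "b = x \<or> b = y"
      using cubic_nbrs[of s a x y b] xy sE st ne by blast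
    then obtain d where d: "E b d" "E s d" "d \<noteq> b" "d \<noteq> a"
      using xy adj_sym adj_irrefl st by blast
    have "d \<notin> S" using valid_not_near[OF valid_S A(1)] d(2) adj_irrefl unfolding near_def by blast
    then have "d \<in> P" using P_closed A(2) d(1) by blast
    then show False
      using P_triangle_third_low[OF a(1) A(2,1,5,8) ne(1) d(2) d(4,3)] by blast
  qed
  ultimately have valid': "valid ?S" unfolding valid_def by blast
  obtain f u where f: "card (mono_arcs S f) = n" "(a, u) \<in> mono_arcs S f" using a by (auto simp: P_def)
  have "\<exists>g. mono_arcs S g = mono_arcs S f \<and> (\<forall>d. E s d \<longrightarrow> d \<noteq> a \<longrightarrow> g d = g b)"
  proof (cases "\<exists>d. E s d \<and> d \<noteq> a \<and> d \<noteq> b")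
    case True
    then obtain d where d: "E s d" "d \<noteq> a" "d \<noteq> b" by blast
    have uniq: "q = b \<or> q = d" if "E s q" "q \<noteq> a" for q
      using cubic_nbrs[of s a b d q] sE d ne that by blast
    have dP: "d \<notin> P" using P_triangle_third_low[OF a(1) A(2,1,5,8) ne(1) d] .
    show ?thesis
    proof (cases "f d = f b")
      case True
      then show ?thesis using uniq by blast
    next
      case False
      then show ?thesis
        using uniq dP A(2) mono_flip_P[of f]
        by (intro exI[of _ "\<lambda>x. if x \<in> P then \<not> f x else f x"]) auto
    qed
  next
    case False
    then show ?thesis by blast
  qed
  then obtain g where g: "mono_arcs S g = mono_arcs S f" "\<And>d. E s d \<Longrightarrow> d \<noteq> a \<Longrightarrow> g d = g b" by blast
  \<comment> \<open>Arcs at \<open>a\<close> vanish, and \<open>s\<close> gets the colour opposite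
    to all its neighbours other than \<open>a\<close>.\<close>
  have "mono_arcs ?S (g(s := \<not> g b)) \<subseteq> mono_arcs S f"
  proof (rule subrelI)
    fix x y assume "(x, y) \<in> mono_arcs ?S (g(s := \<not> g b))"
    then have xy: "E x y" "E y x" "x \<noteq> a" "y \<noteq> a" "x \<noteq> y" "x \<in> S \<Longrightarrow> x = s" "y \<in> S \<Longrightarrow> y = s"
      "(g(s := \<not> g b)) x = (g(s := \<not> g b)) y"
      using adj_sym adj_irrefl by (auto simp: mono_arcs_iff)
    have "x \<noteq> s" using xy g(2)[of y] by auto
    moreover have "y \<noteq> s" using xy g(2)[of x] by auto
    ultimately have "(x, y) \<in> mono_arcs S g" using xy by (auto simp: mono_arcs_iff)
    then show "(x, y) \<in> mono_arcs S f" using g by simp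
  qed
  moreover have "(a, u) \<notin> mono_arcs ?S (g(s := \<not> g b))" by (simp add: mono_arcs_iff)
  ultimately show False using no_improvement[OF valid' f(1)] f(2) by blast
qed

lemma P_not_low: "p \<in> P \<Longrightarrow> \<not> low p"
  using low_P_has_cubic_nbr cubic_P_low_nbr adj_sym by blast

section \<open>The case that all vertices of \<open>P\<close> are cubic\<close>

lemma P_empty: "P = {}"
proof (rule ccontr)
  assume ne: "P \<noteq> {}"
  \<comment> \<open>\<open>R\<close> joins the two vertices of \<open>P\<close> in the same triangle; the other edges on \<open>P\<close> form the
    second matching.\<close>
  define R where "R p b \<longleftrightarrow> E p b \<and> b \<notin> S \<and> (\<exists>s\<in>S. E p s \<and> E b s)" for p b
  have R_sym: "R b p" if "R p b" "p \<in> P" for p b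
    using that adj_sym P_not_S unfolding R_def by blast
  have R_ex: "\<exists>b. R p b" if "p \<in> P" for p
    using cubic_P_structure[OF that P_not_low[OF that]] P_not_S unfolding R_def by metis
  \<comment> \<open>Two vertices of \<open>S\<close> adjacent to \<open>p\<close> would be near each
    other, so \<open>b\<close> and \<open>b'\<close> arise from the same \<open>s\<close>, which has
    no third neighbour in \<open>P\<close>.\<close>
  have R_uniq: "b = b'" if pR: "p \<in> P" "R p b" "R p b'" for p b b'
  proof (rule ccontr)
    assume bb: "b \<noteq> b'"
    obtain s s' where s: "s \<in> S" "E p s" "E b s" "s' \<in> S" "E p s'" "E b' s'"
      using pR unfolding R_def by blast
    have "s = s'" using valid_not_near[OF valid_S s(1,4)] s adj_sym unfolding near_def by blast
    moreover have "b \<in> P" "b' \<in> P" using pR P_closed unfolding R_def by blast+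
    moreover have "p \<noteq> b" "p \<noteq> b'" using pR adj_irrefl unfolding R_def by blast+
    ultimately show False
      using P_triangle_third_low[OF pR(1), of b s b'] s bb adj_sym by blast
  qed
  have Q_ex: "\<exists>c. E p c \<and> c \<notin> S \<and> \<not> R p c" if "p \<in> P" for p
    using P_nbrs[OF that] P_not_S R_uniq[OF that] by metis
  have Q_uniq: "c = c'" if pQ: "p \<in> P" "E p c" "c \<notin> S" "\<not> R p c" "E p c'" "c' \<notin> S" "\<not> R p c'" for p c c'
  proof -
    obtain b where "R p b" using R_ex[OF pQ(1)] by blast
    then show ?thesis
      using valid_residual_degree[OF valid_S P_not_S[OF pQ(1)], of b c c'] pQ
      unfolding R_def by blast
  qed
  obtain t where t: "\<And>p. p \<in> P \<Longrightarrow> R p (t p)" using R_ex by metis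
  obtain r where r: "\<And>p. p \<in> P \<Longrightarrow> E p (r p) \<and> r p \<notin> S \<and> \<not> R p (r p)" using Q_ex by metis
  have tP: "t p \<in> P \<and> t (t p) = p \<and> t p \<noteq> p" if p: "p \<in> P" for p
  proof -
    have "t p \<in> P" using t[OF p] P_closed[OF p] unfolding R_def by blast
    moreover have "t (t p) = p" using R_uniq[OF calculation t[OF calculation] R_sym[OF t[OF p] p]] .
    moreover have "t p \<noteq> p" using t[OF p] adj_irrefl unfolding R_def by metis
    ultimately show ?thesis by blast
  qed
  have rP: "r p \<in> P \<and> r (r p) = p \<and> r p \<noteq> p" if p: "p \<in> P" for p
  proof -
    have rp: "r p \<in> P" using r[OF p] P_closed[OF p] by blast
    moreover have "r (r p) = p"
      using Q_uniq[OF rp, of "r (r p)" p] r[OF rp] r[OF p] R_sym[OF _ rp] P_not_S[OF p] adj_sym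
      by blast
    moreover have "r p \<noteq> p" using r[OF p] adj_irrefl by metis
    ultimately show ?thesis by blast
  qed
  have "finite P" by (rule finite_subset[OF _ finite_V]) (use P_V in blast)
  then obtain h where h: "\<forall>p\<in>P. h (t p) = (\<not> h p) \<and> h (r p) = (\<not> h p)"
    using two_matchings_bipartite[OF _ tP rP] by blast
  obtain p where p: "p \<in> P" using ne by blast
  then obtain f u where f: "card (mono_arcs S f) = n" "(p, u) \<in> mono_arcs S f" by (auto simp: P_def)
  \<comment> \<open>No edge outside \<open>S\<close> leaves \<open>P\<close>, so \<open>h\<close> on
    \<open>P\<close> and \<open>f\<close> elsewhere do not interfere.\<close>
  let ?g = "\<lambda>x. if x \<in> P then h x else f x"
  have proper: "x \<notin> P" if xy: "(x, y) \<in> mono_arcs S ?g" for x y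
  proof
    assume x: "x \<in> P"
    have y: "E x y" "y \<notin> S" "?g x = ?g y" using xy by (auto simp: mono_arcs_iff)
    have "y = t x \<or> y = r x"
      using R_uniq[OF x _ t[OF x], of y] Q_uniq[OF x y(1,2), of "r x"] r[OF x] by blast
    moreover have "y \<in> P" using P_closed[OF x] y by blast
    ultimately show False using bspec[OF h x] x y(3) by auto
  qed
  have "mono_arcs S ?g \<subseteq> mono_arcs S f"
  proof (rule subrelI)
    fix x y assume xy: "(x, y) \<in> mono_arcs S ?g"
    have "x \<notin> P" "y \<notin> P" using proper[OF xy] proper[OF mono_arcs_sym[OF xy]] .
    then show "(x, y) \<in> mono_arcs S f" using xy by (simp add: mono_arcs_iff)
  qed
  moreover have "(p, u) \<notin> mono_arcs S ?g" using proper p by blast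
  ultimately show False using no_improvement[OF valid_S f(1)] f(2) by blast
qed

end

text \<open>A monochromatic edge of a minimising colouring would have its ends in \<open>P\<close>,
  which is empty.\<close>

theorem (in saturated_cubic) packing_with_bipartite_complement:
  "\<exists>S f. packing S \<and> (\<forall>u v. E u v \<longrightarrow> u \<notin> S \<longrightarrow> v \<notin> S \<longrightarrow> (f u :: bool) \<noteq> f v)"
proof -
  define c where "c = (\<lambda>(S, f). card (mono_arcs S f))"
  obtain S0 where "valid S0" using triangle_transversal_packing unfolding valid_def by blast
  then have "\<exists>x. valid (fst x) \<and> (\<forall>y. valid (fst y) \<longrightarrow> c x \<le> c y)"
    using ex_has_least_nat[of "\<lambda>x. valid (fst x)" "(S0, undefined)" c] by auto
  then obtain S f where S: "valid S" and min: "\<And>S' g. valid S' \<Longrightarrow> card (mono_arcs S f) \<le> card (mono_arcs S' g)"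
    by (auto simp: c_def)
  interpret minimal_packing V E S "card (mono_arcs S f)"
    by unfold_locales (use S min in auto)
  have "mono_arcs S f = {}" using P_empty unfolding P_def by fast
  then show ?thesis using S unfolding valid_def mono_arcs_def by blast
qed

subsection \<open>Distances and local girth\<close>

text \<open>Lengths are integers, so all walks have length at least \<open>k + 1\<close>, and this
  bound passes to the infimum, which is infinite if there is no walk.\<close>

lemma (in pair_wf_digraph) graph_dist_gt:
  assumes "\<And>p. awalk u p v \<Longrightarrow> k < length p"
  shows "graph_dist G u v > ereal (real k)"
proof -
  have cost: "awalk_cost (\<lambda>_. 1) p = real (length p)" for p
    by (induction p) auto
  have "ereal (real (Suc k)) \<le> \<mu> (\<lambda>_. 1) u v"
    unfolding \<mu>_def cost
  proof (rule INF_greatest)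
    fix p assume "p \<in> {p. awalk u p v}"
    then have "Suc k \<le> length p" using assms[of p] by auto
    then show "ereal (real (Suc k)) \<le> ereal (real (length p))" by simp
  qed
  moreover have "ereal (real k) < ereal (real (Suc k))" by simp
  ultimately show ?thesis unfolding graph_dist_def by (rule less_le_trans[rotated])
qed

lemma (in pair_wf_digraph) graph_dist_gt_1:
  assumes "u \<noteq> v" "(u, v) \<notin> parcs G"
  shows "graph_dist G u v > ereal (real 1)"
proof (rule graph_dist_gt)
  fix p assume "awalk u p v"
  then show "1 < length p"
    using assms by (cases p; cases "tl p") (auto simp: awalk_simps)
qed

lemma (in pair_wf_digraph) graph_dist_gt_2:
  assumes "u \<noteq> v" "(u, v) \<notin> parcs G" "\<And>m. (u, m) \<in> parcs G \<Longrightarrow> (m, v) \<notin> parcs G"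
  shows "graph_dist G u v > ereal (real 2)"
proof (rule graph_dist_gt)
  fix p assume "awalk u p v"
  then show "2 < length p"
    using assms by (cases p; cases "tl p"; cases "tl (tl p)") (auto simp: awalk_simps)
qed

lemma degree_eq_card_nbrs: "degree G v = card {w. (v, w) \<in> parcs G}"
proof -
  have "out_arcs (with_proj G) v = Pair v ` {w. (v, w) \<in> parcs G}"
    by (auto simp: out_arcs_def)
  then show ?thesis
    unfolding degree_def out_degree_def by (simp add: card_image inj_on_def)
qed

text \<open>An infimum below 4 yields a cycle through \<open>v\<close> with exactly three arcs, and
  symmetry makes it a triangle at \<open>v\<close>.\<close>

lemma (in pair_graph) local_girth_3_triangle:
  assumes "local_girth G v \<le> 3"
  shows "\<exists>a b. (v, a) \<in> parcs G \<and> (v, b) \<in> parcs G \<and> (a, b) \<in> parcs G"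
proof -
  let ?C = "{p. undirected_cycle G p \<and> v \<in> fst ` set p}"
  have "(INF p\<in>?C. enat (length p)) < enat 4"
    using assms unfolding local_girth_def
    by (rule le_less_trans) (simp add: numeral_eq_enat)
  then obtain p where p: "undirected_cycle G p" "v \<in> fst ` set p" "length p < 4"
    unfolding INF_less_iff by auto
  then have "length p = 3" unfolding undirected_cycle_def by simp
  then obtain e1 e2 e3 where e: "p = [e1, e2, e3]"
    by (auto simp: numeral_3_eq_3 length_Suc_conv)
  obtain u where "awalk u p u" using p(1) unfolding undirected_cycle_def cycle_def by blast
  then obtain a b c where abc: "(a, b) \<in> parcs G" "(b, c) \<in> parcs G" "(c, a) \<in> parcs G"
    "v \<in> {a, b, c}"
    using p(2) unfolding e by (cases e1; cases e2; cases e3) (auto simp: awalk_simps)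
  then have "(b, a) \<in> parcs G" "(c, b) \<in> parcs G" "(a, c) \<in> parcs G"
    using pair_sym_arcs by (auto simp: symmetric_def elim: symE)
  with abc show ?thesis by blast
qed

theorem theorem3:
  fixes G :: "'a pair_pre_digraph"
  assumes "pair_graph G"
    and "subcubic G"
    and "saturated 2 G"
    and "g3 G = 3"
  shows "packing_colorable [1, 1, 2] G"
proof -
  interpret G: pair_graph G by fact
  let ?E = "\<lambda>u v. (u, v) \<in> parcs G"
  have inV: "u \<in> pverts G" "v \<in> pverts G" if "?E u v" for u v
    using that G.wellformed' by blast+
  have deg_pos: "v \<in> pverts G" if "card {w. ?E v w} = 3" for v
    using that inV(1) by (cases "{w. ?E v w} = {}") auto
  interpret saturated_cubic "pverts G" ?E
  proof
    show "finite (pverts G)" by (rule G.pair_finite_verts)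
    show "u \<in> pverts G" if "?E u v" for u v using that by (rule inV)
    show "?E v u" if "?E u v" for u v
      using that G.pair_sym_arcs by (auto simp: symmetric_def elim: symE)
    show "\<not> ?E v v" for v using G.pair_no_loops by force
    show "card {w. ?E v w} \<le> 3" for v
    proof (cases "v \<in> pverts G")
      case True
      then show ?thesis using assms(2) by (simp add: subcubic_def degree_eq_card_nbrs)
    next
      case False
      then have "{w. ?E v w} = {}" using inV by blast
      then show ?thesis by simp
    qed
    show "\<exists>w. ?E v w \<and> card {x. ?E w x} \<le> 2" if c: "card {w. ?E v w} = 3" for v
    proof (rule ccontr)
      assume no: "\<not> ?thesis"
      have "degree G w = 3" if "?E v w" for w
        using no that assms(2) inV(2)[OF that]
        by (force simp: subcubic_def degree_eq_card_nbrs not_le)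
      then have "{w \<in> pverts G. ?E v w \<and> degree G w = 3} = {w. ?E v w}"
        using inV(2) by blast
      then show False
        using c assms(3) deg_pos[OF c] unfolding saturated_def degree_eq_card_nbrs by auto
    qed
    show "\<exists>a b. ?E v a \<and> ?E v b \<and> ?E a b" if c: "card {w. ?E v w} = 3" for v
    proof (rule G.local_girth_3_triangle)
      have "local_girth G v \<le> g3 G"
        unfolding g3_def using c deg_pos[OF c] by (intro SUP_upper) (simp add: degree_eq_card_nbrs)
      then show "local_girth G v \<le> 3" using assms(4) by simp
    qed
  qed
  obtain S f where S: "packing S"
    and f: "\<And>u v. ?E u v \<Longrightarrow> u \<notin> S \<Longrightarrow> v \<notin> S \<Longrightarrow> (f u :: bool) \<noteq> f v"
    using packing_with_bipartite_complement by blast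
  \<comment> \<open>Index 2 carries the distance bound 2 and gets the packing; indices 0 and 1 get
    the two sides of the bipartition.\<close>
  define W where "W i = (if i = (2::nat) then S else {v \<in> pverts G. v \<notin> S \<and> f v = (i = 0)})" for i
  have "packing_coloring [1, 1, 2] G W"
    unfolding packing_coloring_def
  proof (intro conjI allI impI ballI)
    have "{..<length [1, 1, 2::nat]} = {0, 1, 2}" by auto
    then show "(\<Union>i<length [1, 1, 2::nat]. W i) = pverts G"
      using S by (auto simp: W_def packing_def)
    show "disjoint_family_on W {..<length [1, 1, 2::nat]}"
      by (auto simp: disjoint_family_on_def W_def less_Suc_eq)
    fix i u v
    assume i: "i < length [1, 1, 2::nat]" and uv: "u \<in> W i" "v \<in> W i" "u \<noteq> v"
    show "graph_dist G u v > ereal (real ([1, 1, 2] ! i))"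
    proof (cases "i = 2")
      case True
      then have "\<not> near u v" using S uv by (auto simp: W_def packing_def)
      then show ?thesis using True uv(3) G.graph_dist_gt_2[of u v] by (auto simp: near_def)
    next
      case False
      then have "[1, 1, 2] ! i = (1::nat)" using i by (auto simp: less_Suc_eq)
      moreover have "\<not> ?E u v" using f[of u v] uv False by (auto simp: W_def)
      ultimately show ?thesis using uv(3) G.graph_dist_gt_1[of u v] by simp
    qed
  qed
  then show ?thesis unfolding packing_colorable_def by blast
qed

end
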